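(* Let $(G,g)$ be a connected, simply connected three-dimensional Lie group with a left-invariant Lorentzian metric of Type Ib, i.e. its Lie algebra admits an orthonormal basis $\{e_1,e_2,e_3\}$ of signature $(++-)$ with $$[e_1,e_2]=\beta e_2-\gamma e_3,\quad [e_1,e_3]=-\gamma e_2-\beta e_3,\quad [e_2,e_3]=\alpha e_1$$ for some $\alpha,\beta,\gamma\in\mathbb{R}$ with $\beta\neq 0$. Then $(G,g)$ does not admit any non-zero left-invariant Cotton soliton: there is no non-zero left-invariant vector field $X$ on $G$ satisfying $\mathcal{L}_Xg+C=\lambda g$ for some $\lambda\in\mathbb{R}$.
   Context: Let $\nabla$ be the Levi-Civita connection of a three-dimensional pseudo-Riemannian manifold, $R(X,Y)=\nabla_{[X,Y]}-[\nabla_X,\nabla_Y]$, Ricci tensor $\rho(X,Y)=\operatorname{trace}\{Z\mapsto R(X,Z)Y\}$, scalar curvature $\tau$, Schouten tensor $S=\rho-\frac{\tau}{4}g$. The $(0,3)$-Cotton tensor is $C_{ijk}=(\nabla_iS)_{jk}-(\nabla_jS)_{ik}$, and the $(0,2)$-Cotton tensor is $C_{ij}=\frac{1}{2\sqrt{|\det g|}}C_{nmi}\,\epsilon^{nm\ell}g_{\ell j}$, where $\epsilon^{ijk}$ is the Levi-Civita symbol with $\epsilon^{123}=1$; here the orientation is the one for which $\{e_1,e_2,e_3\}$ is positively oriented. Signature $(++-)$ means $g(e_1,e_1)=g(e_2,e_2)=-g(e_3,e_3)=1$. A Cotton soliton is a vector field $X$ satisfying $\mathcal{L}_Xg+C=\lambda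 g$ for some $\lambda\in\mathbb{R}$. *)

theory Defs
  imports "HOL-Analysis.Analysis" "HOL-Library.Function_Algebras"
begin

section \<open>Smooth manifolds\<close>

text \<open>For an open set \<open>S\<close> in a finite-dimensional space this is the usual notion: all iterated
  directional derivatives exist as Frechet derivatives and are continuous.\<close>

primrec Ck_on :: "nat \<Rightarrow> ('e::euclidean_space \<Rightarrow> 'f::real_normed_vector) \<Rightarrow> 'e set \<Rightarrow> bool" where
  "Ck_on 0 f S \<longleftrightarrow> continuous_on S f"
| "Ck_on (Suc k) f S \<longleftrightarrow> (\<forall>x\<in>S. f differentiable (at x)) \<and>
     (\<forall>v. Ck_on k (\<lambda>x. frechet_derivative f (at x) v) S)"

definition smooth_on :: "('e::euclidean_space \<Rightarrow> 'f::real_normed_vector) \<Rightarrow> 'e set \<Rightarrow> bool" where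
  "smooth_on f S \<longleftrightarrow> (\<forall>k. Ck_on k f S)"

text \<open>A chart is a pair of its domain and its coordinate map; values of the coordinate map outside
  the domain are irrelevant. The manifold is the whole type.\<close>

type_synonym ('a, 'e) atlas = "('a set \<times> ('a \<Rightarrow> 'e)) set"

definition smooth_manifold ::
  "('a::{t2_space, second_countable_topology}, 'e::euclidean_space) atlas \<Rightarrow> bool" where
  "smooth_manifold A \<longleftrightarrow>
     (\<forall>(U, \<phi>)\<in>A. open U \<and> open (\<phi> ` U) \<and> homeomorphism U (\<phi> ` U) \<phi> (inv_into U \<phi>)) \<and>
     (\<Union>(U, \<phi>)\<in>A. U) = UNIV \<and>
     (\<forall>(U, \<phi>)\<in>A. \<forall>(V, \<psi>)\<in>A. smooth_on (\<psi> \<circ> inv_into U \<phi>) (\<phi> ` (U \<inter> V)))"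

definition smooth_map ::
  "('a::topological_space, 'e::euclidean_space) atlas \<Rightarrow>
   ('b::topological_space, 'f::euclidean_space) atlas \<Rightarrow> ('a \<Rightarrow> 'b) \<Rightarrow> bool" where
  "smooth_map A B F \<longleftrightarrow> continuous_on UNIV F \<and>
     (\<forall>(U, \<phi>)\<in>A. \<forall>(V, \<psi>)\<in>B. smooth_on (\<psi> \<circ> F \<circ> inv_into U \<phi>) (\<phi> ` (U \<inter> F -` V)))"

definition prod_atlas :: "('a, 'e) atlas \<Rightarrow> ('b, 'f) atlas \<Rightarrow> ('a \<times> 'b, 'e \<times> 'f) atlas" where
  "prod_atlas A B = {(U \<times> V, map_prod \<phi> \<psi>) | U \<phi> V \<psi>. (U, \<phi>) \<in> A \<and> (V, \<psi>) \<in> B}"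

definition smooth_fun ::
  "('a::topological_space, 'e::euclidean_space) atlas \<Rightarrow> ('a \<Rightarrow> real) \<Rightarrow> bool" where
  "smooth_fun A f \<longleftrightarrow> smooth_map A {(UNIV, id)} f"


section \<open>Tangent vectors and vector fields\<close>

text \<open>A tangent vector at \<open>p\<close> is the operator taking a smooth function to its directional derivative
  at \<open>p\<close> along some vector of the model space, in the coordinates of a chart. By the chain rule it
  does not matter which chart around \<open>p\<close> is used. So that equality of tangent vectors is equality
  of operators, the value on functions that are not smooth is fixed to be 0. Sums, differences and
  0 of tangent vectors and of vector fields are the pointwise ones.\<close>

type_synonym 'a tvec = "('a \<Rightarrow> real) \<Rightarrow> real"
type_synonym 'a vfield = "'a \<Rightarrow> 'a tvec"

definition tangent_space ::
  "('a::topological_space, 'e::euclidean_space) atlas \<Rightarrow> 'a \<Rightarrow> 'a tvec set" where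
  "tangent_space A p = {v. (\<forall>f. \<not> smooth_fun A f \<longrightarrow> v f = 0) \<and>
     (\<forall>(U, \<phi>)\<in>A. p \<in> U \<longrightarrow>
       (\<exists>w. \<forall>f. smooth_fun A f \<longrightarrow>
          v f = frechet_derivative (f \<circ> inv_into U \<phi>) (at (\<phi> p)) w))}"

definition deriv_along :: "'a vfield \<Rightarrow> ('a \<Rightarrow> real) \<Rightarrow> ('a \<Rightarrow> real)" where
  "deriv_along X f = (\<lambda>p. X p f)"

definition vfields :: "('a::topological_space, 'e::euclidean_space) atlas \<Rightarrow> 'a vfield set" where
  "vfields A = {X. (\<forall>p. X p \<in> tangent_space A p) \<and>
     (\<forall>f. smooth_fun A f \<longrightarrow> smooth_fun A (deriv_along X f))}"

definition fscale :: "('a \<Rightarrow> real) \<Rightarrow> 'a vfield \<Rightarrow> 'a vfield" (infixr \<open>\<odot>\<close> 75) where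
  "h \<odot> X = (\<lambda>p f. h p * X p f)"

definition bracket :: "'a vfield \<Rightarrow> 'a vfield \<Rightarrow> 'a vfield" where
  "bracket X Y = (\<lambda>p f. X p (deriv_along Y f) - Y p (deriv_along X f))"


section \<open>Pseudo-Riemannian metrics and the Levi-Civita connection\<close>

type_synonym 'a metric = "'a \<Rightarrow> 'a tvec \<Rightarrow> 'a tvec \<Rightarrow> real"

definition metric_on :: "'a metric \<Rightarrow> 'a vfield \<Rightarrow> 'a vfield \<Rightarrow> ('a \<Rightarrow> real)" where
  "metric_on g X Y = (\<lambda>p. g p (X p) (Y p))"

definition pseudo_riemannian_metric ::
  "('a::topological_space, 'e::euclidean_space) atlas \<Rightarrow> 'a metric \<Rightarrow> bool" where
  "pseudo_riemannian_metric A g \<longleftrightarrow>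
     (\<forall>p. \<forall>u\<in>tangent_space A p. \<forall>v\<in>tangent_space A p.
        g p u v = g p v u \<and>
        (\<forall>w\<in>tangent_space A p. g p (u + v) w = g p u w + g p v w) \<and>
        (\<forall>c. g p (\<lambda>f. c * u f) v = c * g p u v)) \<and>
     (\<forall>p. \<forall>u\<in>tangent_space A p. (\<forall>v\<in>tangent_space A p. g p u v = 0) \<longrightarrow> u = 0) \<and>
     (\<forall>X\<in>vfields A. \<forall>Y\<in>vfields A. smooth_fun A (metric_on g X Y))"

type_synonym 'a connection = "'a vfield \<Rightarrow> 'a vfield \<Rightarrow> 'a vfield"

definition affine_connection ::
  "('a::topological_space, 'e::euclidean_space) atlas \<Rightarrow> 'a connection \<Rightarrow> bool" where
  "affine_connection A D \<longleftrightarrow>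
     (\<forall>X\<in>vfields A. \<forall>Y\<in>vfields A. D X Y \<in> vfields A \<and>
        (\<forall>Z\<in>vfields A. D (X + Y) Z = D X Z + D Y Z \<and> D Z (X + Y) = D Z X + D Z Y) \<and>
        (\<forall>h. smooth_fun A h \<longrightarrow> D (h \<odot> X) Y = h \<odot> D X Y \<and>
                               D X (h \<odot> Y) = deriv_along X h \<odot> Y + h \<odot> D X Y))"

definition levi_civita ::
  "('a::topological_space, 'e::euclidean_space) atlas \<Rightarrow> 'a metric \<Rightarrow> 'a connection \<Rightarrow> bool" where
  "levi_civita A g D \<longleftrightarrow> affine_connection A D \<and>
     (\<forall>X\<in>vfields A. \<forall>Y\<in>vfields A. D X Y - D Y X = bracket X Y \<and>
        (\<forall>Z\<in>vfields A.
           deriv_along Z (metric_on g X Y) = metric_on g (D Z X) Y + metric_on g X (D Z Y)))"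


section \<open>Curvature\<close>

text \<open>\<open>R(X,Y) = D\<^bsub>[X,Y]\<^esub> - [D\<^sub>X, D\<^sub>Y]\<close>; note the sign.\<close>

definition curvature :: "'a connection \<Rightarrow> 'a vfield \<Rightarrow> 'a vfield \<Rightarrow> 'a vfield \<Rightarrow> 'a vfield" where
  "curvature D X Y Z = D (bracket X Y) Z - (D X (D Y Z) - D Y (D X Z))"

text \<open>On a Lie group there are global frames, i.e. vector fields \<open>E i\<close> whose values form a basis of
  every tangent space (for instance any basis of the Lie algebra). Traces and components are taken
  with respect to such a frame \<open>E\<close>. The tensors \<open>ricci\<close>, \<open>scalar_curvature\<close>, \<open>schouten\<close> and
  \<open>cotton03\<close> do not depend on the frame; \<open>cotton02\<close> depends only on its orientation.\<close>

definition frame_coord :: "('n::finite \<Rightarrow> 'a vfield) \<Rightarrow> 'a \<Rightarrow> 'a tvec \<Rightarrow> real^'n" where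
  "frame_coord E p v = (THE c. v = (\<lambda>f. \<Sum>i\<in>UNIV. c $ i * E i p f))"

definition trace_at ::
  "('n::finite \<Rightarrow> 'a vfield) \<Rightarrow> ('a vfield \<Rightarrow> 'a vfield) \<Rightarrow> 'a \<Rightarrow> real" where
  "trace_at E T p = trace (\<chi> i j. frame_coord E p (T (E j) p) $ i)"

definition gram :: "('n::finite \<Rightarrow> 'a vfield) \<Rightarrow> 'a metric \<Rightarrow> 'a \<Rightarrow> real^'n^'n" where
  "gram E g p = (\<chi> i j. g p (E i p) (E j p))"

definition ricci ::
  "('n::finite \<Rightarrow> 'a vfield) \<Rightarrow> 'a connection \<Rightarrow> 'a vfield \<Rightarrow> 'a vfield \<Rightarrow> ('a \<Rightarrow> real)" where
  "ricci E D X Y = (\<lambda>p. trace_at E (\<lambda>Z. curvature D X Z Y) p)"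

definition scalar_curvature ::
  "('n::finite \<Rightarrow> 'a vfield) \<Rightarrow> 'a metric \<Rightarrow> 'a connection \<Rightarrow> ('a \<Rightarrow> real)" where
  "scalar_curvature E g D =
     (\<lambda>p. \<Sum>i\<in>UNIV. \<Sum>j\<in>UNIV. matrix_inv (gram E g p) $ i $ j * ricci E D (E i) (E j) p)"

text \<open>The Schouten tensor, with the factor 1/4 of dimension three.\<close>

definition schouten ::
  "(3 \<Rightarrow> 'a vfield) \<Rightarrow> 'a metric \<Rightarrow> 'a connection \<Rightarrow> 'a vfield \<Rightarrow> 'a vfield \<Rightarrow> ('a \<Rightarrow> real)" where
  "schouten E g D X Y = (\<lambda>p. ricci E D X Y p - scalar_curvature E g D p / 4 * metric_on g X Y p)"

definition cov_deriv ::
  "'a connection \<Rightarrow> ('a vfield \<Rightarrow> 'a vfield \<Rightarrow> ('a \<Rightarrow> real)) \<Rightarrow>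
   'a vfield \<Rightarrow> 'a vfield \<Rightarrow> 'a vfield \<Rightarrow> ('a \<Rightarrow> real)" where
  "cov_deriv D T X Y Z = deriv_along X (T Y Z) - T (D X Y) Z - T Y (D X Z)"

definition cotton03 ::
  "(3 \<Rightarrow> 'a vfield) \<Rightarrow> 'a metric \<Rightarrow> 'a connection \<Rightarrow>
   'a vfield \<Rightarrow> 'a vfield \<Rightarrow> 'a vfield \<Rightarrow> ('a \<Rightarrow> real)" where
  "cotton03 E g D X Y Z =
     cov_deriv D (schouten E g D) X Y Z - cov_deriv D (schouten E g D) Y X Z"

definition levi_civita_symbol :: "3 \<Rightarrow> 3 \<Rightarrow> 3 \<Rightarrow> real" where
  "levi_civita_symbol i j k =
     (if (i, j, k) \<in> {(1, 2, 3), (2, 3, 1), (3, 1, 2)} then 1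
      else if (i, j, k) \<in> {(1, 3, 2), (3, 2, 1), (2, 1, 3)} then -1 else 0)"

definition cotton02_comp ::
  "(3 \<Rightarrow> 'a vfield) \<Rightarrow> 'a metric \<Rightarrow> 'a connection \<Rightarrow> 3 \<Rightarrow> 3 \<Rightarrow> ('a \<Rightarrow> real)" where
  "cotton02_comp E g D i j = (\<lambda>p. 1 / (2 * sqrt \<bar>det (gram E g p)\<bar>) *
     (\<Sum>n\<in>UNIV. \<Sum>m\<in>UNIV. \<Sum>l\<in>UNIV.
        cotton03 E g D (E n) (E m) (E i) p * levi_civita_symbol n m l * gram E g p $ l $ j))"

text \<open>The (0,2)-Cotton tensor for the orientation in which the frame \<open>E\<close> is positively oriented.\<close>

definition cotton02 ::
  "(3 \<Rightarrow> 'a vfield) \<Rightarrow> 'a metric \<Rightarrow> 'a connection \<Rightarrow> 'a vfield \<Rightarrow> 'a vfield \<Rightarrow> ('a \<Rightarrow> real)" where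
  "cotton02 E g D X Y = (\<lambda>p. \<Sum>i\<in>UNIV. \<Sum>j\<in>UNIV.
     cotton02_comp E g D i j p * frame_coord E p (X p) $ i * frame_coord E p (Y p) $ j)"

definition lie_deriv_metric ::
  "'a metric \<Rightarrow> 'a vfield \<Rightarrow> 'a vfield \<Rightarrow> 'a vfield \<Rightarrow> ('a \<Rightarrow> real)" where
  "lie_deriv_metric g X Y Z = deriv_along X (metric_on g Y Z)
     - metric_on g (bracket X Y) Z - metric_on g Y (bracket X Z)"

definition cotton_soliton ::
  "('a::topological_space, 'e::euclidean_space) atlas \<Rightarrow> (3 \<Rightarrow> 'a vfield) \<Rightarrow> 'a metric \<Rightarrow>
   'a connection \<Rightarrow> 'a vfield \<Rightarrow> bool" where
  "cotton_soliton A E g D X \<longleftrightarrow> X \<in> vfields A \<and>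
     (\<exists>c::real. \<forall>Y\<in>vfields A. \<forall>Z\<in>vfields A. \<forall>p.
        lie_deriv_metric g X Y Z p + cotton02 E g D Y Z p = c * metric_on g Y Z p)"


section \<open>Lie groups\<close>

definition lie_group ::
  "('a::{t2_space, second_countable_topology}, 'e::euclidean_space) atlas \<Rightarrow>
   ('a \<Rightarrow> 'a \<Rightarrow> 'a) \<Rightarrow> 'a \<Rightarrow> ('a \<Rightarrow> 'a) \<Rightarrow> bool" where
  "lie_group A mul u ginv \<longleftrightarrow> smooth_manifold A \<and> Groups.group mul u ginv \<and>
     smooth_map (prod_atlas A A) A (\<lambda>(x, y). mul x y) \<and> smooth_map A A ginv"

text \<open>The differential of the left translation by \<open>a\<close>.\<close>

definition left_push :: "('a \<Rightarrow> 'a \<Rightarrow> 'a) \<Rightarrow> 'a \<Rightarrow> 'a tvec \<Rightarrow> 'a tvec" where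
  "left_push mul a v = (\<lambda>f. v (f \<circ> mul a))"

definition lie_algebra ::
  "('a::topological_space, 'e::euclidean_space) atlas \<Rightarrow> ('a \<Rightarrow> 'a \<Rightarrow> 'a) \<Rightarrow> 'a vfield set" where
  "lie_algebra A mul = {X \<in> vfields A. \<forall>a p. X (mul a p) = left_push mul a (X p)}"

definition lie_algebra_basis ::
  "('a::topological_space, 'e::euclidean_space) atlas \<Rightarrow> ('a \<Rightarrow> 'a \<Rightarrow> 'a) \<Rightarrow>
   ('n::finite \<Rightarrow> 'a vfield) \<Rightarrow> bool" where
  "lie_algebra_basis A mul E \<longleftrightarrow> (\<forall>i. E i \<in> lie_algebra A mul) \<and>
     (\<forall>X\<in>lie_algebra A mul. \<exists>!c::real^'n. X = (\<Sum>i\<in>UNIV. (\<lambda>_. c $ i) \<odot> E i))"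

definition left_invariant_metric ::
  "('a::topological_space, 'e::euclidean_space) atlas \<Rightarrow> ('a \<Rightarrow> 'a \<Rightarrow> 'a) \<Rightarrow> 'a metric \<Rightarrow> bool" where
  "left_invariant_metric A mul g \<longleftrightarrow> pseudo_riemannian_metric A g \<and>
     (\<forall>a p. \<forall>u\<in>tangent_space A p. \<forall>v\<in>tangent_space A p.
        g (mul a p) (left_push mul a u) (left_push mul a v) = g p u v)"

text \<open>Orthonormal of signature (++-).\<close>

definition lorentz_orthonormal :: "'a metric \<Rightarrow> (3 \<Rightarrow> 'a vfield) \<Rightarrow> bool" where
  "lorentz_orthonormal g E \<longleftrightarrow> (\<forall>i j p. metric_on g (E i) (E j) p =
     (if i \<noteq> j then 0 else if i = 3 then -1 else 1))"

end

theory Submission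
  imports Defs
begin

text \<open>Fields with constant coefficients in the frame \<open>e\<close> are identified with vectors of
  \<open>\<real>\<^sup>3\<close>. Their brackets and scalar products are again constant, so by the Koszul formula the
  Levi-Civita connection acts on \<open>\<real>\<^sup>3\<close> by a bilinear map with coefficients linear in
  \<open>\<alpha>, \<beta>, \<gamma>\<close> (\<open>koszul\<close>, \<open>D_const\<close>). For this one has to know that \<open>e\<close> spans each tangent space,
  since the formula yields only the products of covariant derivatives with the frame; a tangent space is a linear
  image of the model space, so three independent vectors suffice (\<open>tangent_space_spanned\<close>).
  Curvature, Ricci, Schouten and Cotton tensors then become polynomials in \<open>\<alpha>, \<beta>, \<gamma>\<close>.

  Of the Cotton tensor only its shape matters: \<open>C\<^sub>1\<^sub>2 = C\<^sub>1\<^sub>3 = 0\<close> and \<open>C\<^sub>2\<^sub>2 + C\<^sub>3\<^sub>3 = 0\<close>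
  (\<open>cotton02_Ib\<close>). Conceptually, the bracket is \<open>[u,v] = L(u \<times> v)\<close> for a self-adjoint operator
  \<open>L\<close>, and the Cotton operator, being built naturally from \<open>L\<close> and the metric, is a polynomial in
  \<open>L\<close>. In Type Ib, \<open>L\<close> preserves the line of \<open>e\<^sub>1\<close> and the plane of \<open>e\<^sub>2, e\<^sub>3\<close>, and on that plane it
  is a combination of the identity and a complex structure. Polynomials in \<open>L\<close> have the same
  shape, in particular equal diagonal entries on the plane; lowering an index with
  \<open>g\<^sub>2\<^sub>2 = 1 = - g\<^sub>3\<^sub>3\<close> turns this into \<open>C\<^sub>2\<^sub>2 = - C\<^sub>3\<^sub>3\<close>. The proof below checks it by expansion.

  Let \<open>X = x\<^sub>1 e\<^sub>1 + x\<^sub>2 e\<^sub>2 + x\<^sub>3 e\<^sub>3\<close> be a soliton. The components (1,2) and (1,3) of the soliton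
  equation involve neither \<open>C\<close> nor \<open>\<lambda>\<close> and say
  \<open>\<beta> x\<^sub>2 + (\<alpha> - \<gamma>) x\<^sub>3 = 0\<close> and \<open>\<beta> x\<^sub>3 - (\<alpha> - \<gamma>) x\<^sub>2 = 0\<close>, a system with determinant
  \<open>\<beta>\<^sup>2 + (\<alpha> - \<gamma>)\<^sup>2 > 0\<close>. In the sum of the components (2,2) and (3,3) both \<open>C\<close> and \<open>\<lambda>\<close> cancel,
  and \<open>-4 \<beta> x\<^sub>1 = 0\<close> remains. Hence \<open>X = 0\<close> (\<open>cotton_soliton_zero\<close>).\<close>


section \<open>Smooth functions\<close>

text \<open>Openness of \<open>S\<close> is essential: the derivatives in \<open>Ck_on\<close> are taken in the whole space, so
  they see the values of the functions near, not only at, the points of \<open>S\<close>.\<close>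

lemma Ck_on_cong_open:
  assumes "open S" and "\<And>x. x \<in> S \<Longrightarrow> f x = g x" and "Ck_on k f S"
  shows "Ck_on k g S"
  using assms(2,3)
proof (induction k arbitrary: f g)
  case 0
  then show ?case by (auto intro: continuous_on_eq)
next
  case (Suc k)
  have der: "(g has_derivative frechet_derivative f (at x)) (at x)" if "x \<in> S" for x
    using Suc.prems that \<open>open S\<close>
    by (intro has_derivative_transform_within_open[of f _ x UNIV S g])
       (auto simp: frechet_derivative_works[symmetric])
  have "frechet_derivative f (at x) = frechet_derivative g (at x)" if "x \<in> S" for x
    using frechet_derivative_at[OF der[OF that]] .
  moreover have "g differentiable (at x)" if "x \<in> S" for x
    using der[OF that] by (auto simp: differentiable_def)
  moreover have "Ck_on k (\<lambda>x. frechet_derivative g (at x) v) S" for v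
  proof (rule Suc.IH)
    show "Ck_on k (\<lambda>x. frechet_derivative f (at x) v) S"
      using Suc.prems by simp
  qed (simp add: calculation(1))
  ultimately show ?case by simp
qed

lemma Ck_on_const: "Ck_on k (\<lambda>x. c) S"
  by (induction k arbitrary: c) (auto simp: frechet_derivative_const)

lemma frechet_derivative_lincomb:
  assumes "f differentiable (at x)" "g differentiable (at x)"
  shows "(\<lambda>y. a *\<^sub>R f y + b *\<^sub>R g y) differentiable (at x)"
    and "frechet_derivative (\<lambda>y. a *\<^sub>R f y + b *\<^sub>R g y) (at x) v =
         a *\<^sub>R frechet_derivative f (at x) v + b *\<^sub>R frechet_derivative g (at x) v"
proof -
  have "((\<lambda>y. a *\<^sub>R f y + b *\<^sub>R g y) has_derivative
      (\<lambda>v. a *\<^sub>R frechet_derivative f (at x) v + b *\<^sub>R frechet_derivative g (at x) v)) (at x)"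
    using assms by (auto intro!: derivative_eq_intros simp: frechet_derivative_works)
  from frechet_derivative_at[OF this] this
  show "(\<lambda>y. a *\<^sub>R f y + b *\<^sub>R g y) differentiable (at x)"
    "frechet_derivative (\<lambda>y. a *\<^sub>R f y + b *\<^sub>R g y) (at x) v =
      a *\<^sub>R frechet_derivative f (at x) v + b *\<^sub>R frechet_derivative g (at x) v"
    by (auto simp: differentiable_def dest: fun_cong[where x=v])
qed

lemma Ck_on_lincomb:
  assumes "open S" and "Ck_on k f S" and "Ck_on k g S"
  shows "Ck_on k (\<lambda>x. a *\<^sub>R f x + b *\<^sub>R g x) S"
  using assms(2,3)
proof (induction k arbitrary: f g)
  case 0
  then show ?case by (simp add: continuous_on_add continuous_on_scaleR continuous_on_const)
next
  case (Suc k)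
  have dif: "f differentiable (at x)" "g differentiable (at x)" if "x \<in> S" for x
    using Suc.prems that by auto
  have "Ck_on k (\<lambda>x. frechet_derivative (\<lambda>y. a *\<^sub>R f y + b *\<^sub>R g y) (at x) v) S" for v
  proof (rule Ck_on_cong_open[OF \<open>open S\<close>])
    show "Ck_on k (\<lambda>x. a *\<^sub>R frechet_derivative f (at x) v +
        b *\<^sub>R frechet_derivative g (at x) v) S"
      using Suc.prems by (intro Suc.IH) simp_all
  qed (simp add: frechet_derivative_lincomb(2) dif)
  moreover have "(\<lambda>y. a *\<^sub>R f y + b *\<^sub>R g y) differentiable (at x)" if "x \<in> S" for x
    using frechet_derivative_lincomb(1)[OF dif[OF that]] .
  ultimately show ?case by simp
qed

lemma smooth_fun_iff:
  "smooth_fun A f \<longleftrightarrow> continuous_on UNIV f \<and>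
     (\<forall>(U, \<phi>)\<in>A. smooth_on (f \<circ> inv_into U \<phi>) (\<phi> ` U))"
  by (simp add: smooth_fun_def smooth_map_def)

lemma smooth_fun_lincomb:
  assumes A: "smooth_manifold A" and f: "smooth_fun A f" and g: "smooth_fun A g"
  shows "smooth_fun A (\<lambda>p. a * f p + b * g p)"
proof -
  have "smooth_on ((\<lambda>p. a * f p + b * g p) \<circ> inv_into U \<phi>) (\<phi> ` U)" if "(U, \<phi>) \<in> A" for U \<phi>
  proof -
    have "open (\<phi> ` U)" using A that by (auto simp: smooth_manifold_def)
    moreover have "Ck_on k (f \<circ> inv_into U \<phi>) (\<phi> ` U)" "Ck_on k (g \<circ> inv_into U \<phi>) (\<phi> ` U)" for k
      using f g that by (auto simp: smooth_fun_iff smooth_on_def)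
    ultimately show ?thesis
      using Ck_on_lincomb[of "\<phi> ` U" _ "f \<circ> inv_into U \<phi>" "g \<circ> inv_into U \<phi>" a b]
      by (auto simp: smooth_on_def o_def)
  qed
  moreover have "continuous_on UNIV (\<lambda>p. a * f p + b * g p)"
    using f g unfolding smooth_fun_iff
    by (intro continuous_on_add continuous_on_mult_left) blast+
  ultimately show ?thesis
    unfolding smooth_fun_iff by blast
qed

lemma smooth_fun_const: "smooth_fun A (\<lambda>p. c)"
  by (auto simp: smooth_fun_iff smooth_on_def o_def Ck_on_const)

lemma smooth_fun_sum:
  fixes c :: "'i \<Rightarrow> real"
  assumes "smooth_manifold A" and "\<And>i. i \<in> I \<Longrightarrow> smooth_fun A (f i)"
  shows "smooth_fun A (\<lambda>p. \<Sum>i\<in>I. c i * f i p)"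
  using assms(2)
proof (induction I rule: infinite_finite_induct)
  case (insert i I)
  then have "smooth_fun A (f i)" and "smooth_fun A (\<lambda>p. \<Sum>i\<in>I. c i * f i p)"
    by blast+
  from smooth_fun_lincomb[OF assms(1) this, of "c i" 1] show ?case
    using insert.hyps by simp
qed (auto simp: smooth_fun_const)

lemma smooth_fun_differentiable:
  assumes "smooth_fun A f" and "(U, \<phi>) \<in> A" and "p \<in> U"
  shows "(f \<circ> inv_into U \<phi>) differentiable (at (\<phi> p))"
proof -
  have "Ck_on (Suc 0) (f \<circ> inv_into U \<phi>) (\<phi> ` U)"
    using assms unfolding smooth_fun_iff smooth_on_def by blast
  then show ?thesis using assms(3) by auto
qed


section \<open>Tangent vectors\<close>

lemma manifold_chart:
  assumes "smooth_manifold A"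
  obtains U \<phi> where "(U, \<phi>) \<in> A" and "p \<in> U"
  using assms unfolding smooth_manifold_def by blast

lemma tangent_space_nonsmooth:
  "v \<in> tangent_space A p \<Longrightarrow> \<not> smooth_fun A f \<Longrightarrow> v f = 0"
  by (auto simp: tangent_space_def)

lemma tangent_space_coords:
  assumes "v \<in> tangent_space A p" and "(U, \<phi>) \<in> A" and "p \<in> U"
  obtains w where
    "\<And>f. smooth_fun A f \<Longrightarrow> v f = frechet_derivative (f \<circ> inv_into U \<phi>) (at (\<phi> p)) w"
  using assms unfolding tangent_space_def by blast

text \<open>A tangent vector is linear on smooth functions only. On a combination of non-smooth functions
  that happens to be smooth its value need not be the combination of the values, which are 0.\<close>

lemma tangent_vec_lincomb_fun:
  assumes A: "smooth_manifold A" and v: "v \<in> tangent_space A p"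
    and f: "smooth_fun A f" and g: "smooth_fun A g"
  shows "v (\<lambda>q. a * f q + b * g q) = a * v f + b * v g"
proof -
  obtain U \<phi> where U: "(U, \<phi>) \<in> A" "p \<in> U" using manifold_chart[OF A] .
  obtain w where w:
    "\<And>f. smooth_fun A f \<Longrightarrow> v f = frechet_derivative (f \<circ> inv_into U \<phi>) (at (\<phi> p)) w"
    using tangent_space_coords[OF v U] by blast
  show ?thesis
    using frechet_derivative_lincomb(2)[OF smooth_fun_differentiable[OF f U]
        smooth_fun_differentiable[OF g U], of a b w]
    by (simp add: w f g smooth_fun_lincomb[OF A f g] o_def)
qed

lemma tangent_vec_const:
  assumes A: "smooth_manifold A" and v: "v \<in> tangent_space A p"
  shows "v (\<lambda>q. c) = 0"
proof -
  obtain U \<phi> where U: "(U, \<phi>) \<in> A" "p \<in> U" using manifold_chart[OF A] .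
  obtain w where
    "\<And>f. smooth_fun A f \<Longrightarrow> v f = frechet_derivative (f \<circ> inv_into U \<phi>) (at (\<phi> p)) w"
    using tangent_space_coords[OF v U] by blast
  from this[OF smooth_fun_const] show ?thesis by (simp add: o_def)
qed

lemma tangent_vec_sum_fun:
  fixes c :: "'i \<Rightarrow> real"
  assumes A: "smooth_manifold A" and v: "v \<in> tangent_space A p"
    and f: "\<And>i. i \<in> I \<Longrightarrow> smooth_fun A (f i)"
  shows "v (\<lambda>q. \<Sum>i\<in>I. c i * f i q) = (\<Sum>i\<in>I. c i * v (f i))"
  using f
proof (induction I rule: infinite_finite_induct)
  case (insert i I)
  have "smooth_fun A (f i)" and "smooth_fun A (\<lambda>p. \<Sum>i\<in>I. c i * f i p)"
    using insert.prems by (auto intro: smooth_fun_sum[OF A])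
  from tangent_vec_lincomb_fun[OF A v this, of "c i" 1] show ?case
    using insert by simp
qed (auto simp: tangent_vec_const[OF A v])

lemma tangent_space_sum:
  fixes c :: "'i \<Rightarrow> real"
  assumes A: "smooth_manifold A" and v: "\<And>i. i \<in> I \<Longrightarrow> v i \<in> tangent_space A p"
  shows "(\<lambda>f. \<Sum>i\<in>I. c i * v i f) \<in> tangent_space A p"
  unfolding tangent_space_def
proof (safe)
  fix f assume "\<not> smooth_fun A f"
  then show "(\<Sum>i\<in>I. c i * v i f) = 0" 
    using v by (intro sum.neutral) (metis tangent_space_nonsmooth mult_zero_right)
next
  fix U \<phi> assume U: "(U, \<phi>) \<in> A" "p \<in> U"
  have "\<exists>w. \<forall>f. smooth_fun A f \<longrightarrow> v i f = frechet_derivative (f \<circ> inv_into U \<phi>) (at (\<phi> p)) w"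
    if "i \<in> I" for i
    using tangent_space_coords[OF v[OF that] U] by metis
  then obtain w where w: "v i f = frechet_derivative (f \<circ> inv_into U \<phi>) (at (\<phi> p)) (w i)"
    if "i \<in> I" "smooth_fun A f" for i f
    by metis
  have "(\<Sum>i\<in>I. c i * v i f) =
      frechet_derivative (f \<circ> inv_into U \<phi>) (at (\<phi> p)) (\<Sum>i\<in>I. c i *\<^sub>R w i)"
    if f: "smooth_fun A f" for f
  proof -
    have "linear (frechet_derivative (f \<circ> inv_into U \<phi>) (at (\<phi> p)))"
      using smooth_fun_differentiable[OF f U] by (rule linear_frechet_derivative)
    then show ?thesis by (simp add: linear_sum linear_scale w f)
  qed
  then show "\<exists>w. \<forall>f. smooth_fun A f \<longrightarrow>
      (\<Sum>i\<in>I. c i * v i f) = frechet_derivative (f \<circ> inv_into U \<phi>) (at (\<phi> p)) w"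
    by blast
qed

text \<open>Fix a chart at \<open>p\<close>. Each \<open>b i\<close> is differentiation along some \<open>w i\<close> of the model space, and
  independence of the \<open>b i\<close> forces independence of the \<open>w i\<close>. There are as many of them as the
  dimension of the model space, so they span it, and any tangent vector, being differentiation
  along some \<open>z\<close>, inherits the coefficients of \<open>z\<close>.\<close>

lemma tangent_space_spanned:
  fixes A :: "('a::{t2_space, second_countable_topology}, real^'n) atlas"
    and b :: "'n::finite \<Rightarrow> 'a tvec"
  assumes A: "smooth_manifold A" and b: "\<And>i. b i \<in> tangent_space A p"
    and indep: "\<And>c :: real^'n. (\<lambda>f. \<Sum>i\<in>UNIV. c $ i * b i f) = (\<lambda>f. 0) \<Longrightarrow> c = 0"
    and v: "v \<in> tangent_space A p"
  shows "\<exists>c :: real^'n. v = (\<lambda>f. \<Sum>i\<in>UNIV. c $ i * b i f)"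
proof -
  obtain U \<phi> where U: "(U, \<phi>) \<in> A" "p \<in> U" using manifold_chart[OF A] .
  let ?d = "\<lambda>f. frechet_derivative (f \<circ> inv_into U \<phi>) (at (\<phi> p))"
  have lin: "linear (?d f)" if "smooth_fun A f" for f
    using smooth_fun_differentiable[OF that U] by (rule linear_frechet_derivative)
  have "\<exists>w. \<forall>f. smooth_fun A f \<longrightarrow> b i f = ?d f w" for i
    using tangent_space_coords[OF b U] by metis
  then obtain w where w: "b i f = ?d f (w i)" if "smooth_fun A f" for i f
    by metis
  obtain z where z: "v f = ?d f z" if "smooth_fun A f" for f
    using tangent_space_coords[OF v U] by blast
  define L :: "real^'n \<Rightarrow> real^'n" where "L c = (\<Sum>i\<in>UNIV. c $ i *\<^sub>R w i)" for c
  have L: "(\<Sum>i\<in>UNIV. c $ i * b i f) = ?d f (L c)" if "smooth_fun A f" for c f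
    using lin[OF that] by (simp add: L_def linear_sum linear_scale w that)
  have "linear L"
    by (auto simp: L_def linear_iff scaleR_add_left sum.distrib scaleR_sum_right)
  moreover have "inj L"
  proof (subst linear_injective_0[OF \<open>linear L\<close>], safe)
    fix c assume "L c = 0"
    then have "(\<Sum>i\<in>UNIV. c $ i * b i f) = 0" for f
      by (cases "smooth_fun A f") (auto simp: L linear_0 lin tangent_space_nonsmooth[OF b])
    then show "c = 0" by (intro indep) auto
  qed
  ultimately obtain c where "z = L c"
    using linear_injective_imp_surjective by (metis surjD)
  then have "v f = (\<Sum>i\<in>UNIV. c $ i * b i f)" for f
    by (cases "smooth_fun A f")
       (auto simp: z L tangent_space_nonsmooth[OF b] tangent_space_nonsmooth[OF v])
  then show ?thesis by blast
qed


section \<open>Fields with constant coefficients in an orthonormal frame\<close>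

definition const_field :: "('n::finite \<Rightarrow> 'a vfield) \<Rightarrow> real^'n \<Rightarrow> 'a vfield" where
  "const_field E a = (\<lambda>p f. \<Sum>i\<in>UNIV. a $ i * E i p f)"

lemma sum_fscale_eq_const_field: "(\<Sum>i\<in>UNIV. (\<lambda>_. a $ i) \<odot> E i) = const_field E a"
proof -
  have "(\<Sum>i\<in>I. (\<lambda>_. a $ i) \<odot> E i) = (\<lambda>p f. \<Sum>i\<in>I. a $ i * E i p f)" for I
    by (induction I rule: infinite_finite_induct) (auto simp: fun_eq_iff fscale_def)
  then show ?thesis by (simp add: const_field_def)
qed

lemma const_field_axis: "const_field E (axis i 1) = E i"
  by (simp add: const_field_def axis_def fun_eq_iff if_distrib[of "\<lambda>x. x * _"] cong: if_cong)

lemma const_field_diff: "const_field E (a - b) = const_field E a - const_field E b"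
  by (simp add: const_field_def fun_eq_iff left_diff_distrib sum_subtractf)

lemma const_field_zero: "const_field E 0 = 0"
  by (simp add: const_field_def fun_eq_iff)

text \<open>An orthonormal frame whose brackets have constant coefficients. The numbers
  \<open>\<epsilon> i\<close>, equal to 1 or -1, record the signature, and \<open>br\<close> is the bracket of the Lie algebra in coordinates.\<close>

locale orthonormal_frame =
  fixes A :: "('a::{t2_space, second_countable_topology}, real^'n) atlas"
    and g :: "'a metric" and D :: "'a connection"
    and E :: "'n::finite \<Rightarrow> 'a vfield" and \<epsilon> :: "'n \<Rightarrow> real"
    and br :: "real^'n \<Rightarrow> real^'n \<Rightarrow> real^'n"
  assumes manifold: "smooth_manifold A"
    and metric: "pseudo_riemannian_metric A g"
    and levi_civita: "levi_civita A g D"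
    and frame_vfields: "E i \<in> vfields A"
    and metric_frame: "metric_on g (E i) (E j) p = (if i = j then \<epsilon> i else 0)"
    and eps_square: "\<epsilon> i * \<epsilon> i = 1"
    and bracket_const:
      "bracket (const_field E a) (const_field E b) = const_field E (br a b)"
begin

abbreviation F :: "real^'n \<Rightarrow> 'a vfield" where "F \<equiv> const_field E"

definition eta :: "real^'n \<Rightarrow> real^'n \<Rightarrow> real" where
  "eta a b = (\<Sum>i\<in>UNIV. \<epsilon> i * a $ i * b $ i)"

lemma eta_axis: "eta a (axis i 1) = \<epsilon> i * a $ i"
  by (simp add: eta_def axis_def if_distrib[of "\<lambda>x. _ * x"] cong: if_cong)

lemma frame_tangent: "E i p \<in> tangent_space A p"
  using frame_vfields by (auto simp: vfields_def)

lemma const_field_vfields: "F a \<in> vfields A"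
proof -
  have "F a p \<in> tangent_space A p" for p
    unfolding const_field_def by (rule tangent_space_sum[OF manifold frame_tangent])
  moreover have "smooth_fun A (deriv_along (F a) f)" if "smooth_fun A f" for f
  proof -
    have "smooth_fun A (deriv_along (E i) f)" for i
      using frame_vfields that by (auto simp: vfields_def)
    from smooth_fun_sum[OF manifold this, where c = "\<lambda>i. a $ i" and I = UNIV]
    show ?thesis by (simp add: deriv_along_def const_field_def)
  qed
  ultimately show ?thesis by (simp add: vfields_def)
qed

lemma const_field_tangent: "F a p \<in> tangent_space A p"
  using const_field_vfields by (auto simp: vfields_def)

lemma metric_sym:
  "v \<in> tangent_space A p \<Longrightarrow> w \<in> tangent_space A p \<Longrightarrow> g p v w = g p w v"
  using metric unfolding pseudo_riemannian_metric_def by blast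

lemma metric_add_left:
  "v \<in> tangent_space A p \<Longrightarrow> v' \<in> tangent_space A p \<Longrightarrow> w \<in> tangent_space A p \<Longrightarrow>
    g p (v + v') w = g p v w + g p v' w"
  using metric unfolding pseudo_riemannian_metric_def by blast

lemma metric_scale_left:
  "v \<in> tangent_space A p \<Longrightarrow> w \<in> tangent_space A p \<Longrightarrow>
    g p (\<lambda>f. c * v f) w = c * g p v w"
  using metric unfolding pseudo_riemannian_metric_def by blast

lemma metric_sum_left:
  assumes v: "\<And>i. i \<in> I \<Longrightarrow> v i \<in> tangent_space A p" and w: "w \<in> tangent_space A p"
  shows "g p (\<lambda>f. \<Sum>i\<in>I. c i * v i f) w = (\<Sum>i\<in>I. c i * g p (v i) w)"
proof -
  have zero: "g p (\<lambda>f. 0) w = 0"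
    using metric_scale_left[OF w w, of 0] by simp
  show ?thesis using v
  proof (induction I rule: infinite_finite_induct)
    case (insert i I)
    have "(\<lambda>f. \<Sum>j\<in>insert i I. c j * v j f) = (\<lambda>f. c i * v i f) + (\<lambda>f. \<Sum>j\<in>I. c j * v j f)"
      using insert.hyps by (simp add: fun_eq_iff)
    moreover have "(\<lambda>f. c i * v i f) \<in> tangent_space A p"
      using tangent_space_sum[OF manifold, of "{i}" v p c] insert.prems by simp
    moreover have "(\<lambda>f. \<Sum>j\<in>I. c j * v j f) \<in> tangent_space A p"
      using tangent_space_sum[OF manifold, of I v p c] insert.prems by simp
    moreover have "g p (\<lambda>f. \<Sum>j\<in>I. c j * v j f) w = (\<Sum>j\<in>I. c j * g p (v j) w)"
      using insert.IH insert.prems by blast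
    ultimately show ?case
      using insert.hyps insert.prems metric_scale_left[OF _ w, of "v i" "c i"]
      by (simp add: metric_add_left w)
  qed (simp_all add: zero)
qed

lemma metric_const_frame: "g p (F a p) (E i p) = \<epsilon> i * a $ i"
proof -
  have "g p (F a p) (E i p) = (\<Sum>j\<in>UNIV. a $ j * g p (E j p) (E i p))"
    unfolding const_field_def by (rule metric_sum_left[OF frame_tangent frame_tangent])
  also have "\<dots> = (\<Sum>j\<in>UNIV. a $ j * (if j = i then \<epsilon> j else 0))"
    using metric_frame by (simp add: metric_on_def)
  finally show ?thesis by (simp add: if_distrib[of "\<lambda>x. _ * x"] mult.commute cong: if_cong)
qed

lemma metric_const: "g p (F a p) (F b p) = eta a b"
proof -
  have "g p (F a p) (F b p) = g p (F b p) (F a p)"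
    by (intro metric_sym const_field_tangent)
  also have "\<dots> = (\<Sum>j\<in>UNIV. b $ j * g p (E j p) (F a p))"
    unfolding const_field_def[of E b]
    by (rule metric_sum_left[OF frame_tangent const_field_tangent])
  also have "\<dots> = eta a b"
    using metric_const_frame[of p a] metric_sym[OF frame_tangent const_field_tangent]
    by (simp add: eta_def mult_ac)
  finally show ?thesis .
qed

lemma metric_on_const: "metric_on g (F a) (F b) = (\<lambda>p. eta a b)"
  by (simp add: metric_on_def metric_const)

lemma eps_nonzero: "\<epsilon> i \<noteq> 0"
  using eps_square[of i] by auto

lemma const_field_inj: "F a p = F b p \<Longrightarrow> a = b"
  using metric_const_frame[of p a] metric_const_frame[of p b] eps_nonzero
  by (simp add: vec_eq_iff)

lemma frame_coord_const: "frame_coord E p (F a p) = a"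
  unfolding frame_coord_def
  by (rule the_equality) (auto simp: const_field_def intro: const_field_inj[of _ p])

lemma tangent_space_frame:
  assumes "v \<in> tangent_space A p"
  obtains a where "v = F a p"
proof -
  have "c = 0" if "(\<lambda>f. \<Sum>i\<in>UNIV. c $ i * E i p f) = (\<lambda>f. 0)" for c :: "real^'n"
    by (rule const_field_inj[of _ p]) (use that in \<open>simp add: const_field_def\<close>)
  from tangent_space_spanned[where b = "\<lambda>i. E i p", OF manifold frame_tangent this assms]
  obtain c :: "real^'n" where "v = (\<lambda>f. \<Sum>i\<in>UNIV. c $ i * E i p f)" by auto
  then show ?thesis using that by (simp add: const_field_def)
qed

text \<open>A vector field with constant products with the frame has constant coefficients. This is how
  the connection is recovered from the Koszul formula.\<close>

lemma vfield_eq_const: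
  assumes X: "X \<in> vfields A" and prod: "\<And>i p. g p (X p) (E i p) = \<epsilon> i * a $ i"
  shows "X = F a"
proof
  fix p
  have "X p \<in> tangent_space A p" using X by (auto simp: vfields_def)
  then obtain b where b: "X p = F b p" by (rule tangent_space_frame)
  have "b = a"
    using prod[of p] metric_const_frame[of p b] eps_nonzero by (simp add: b vec_eq_iff)
  then show "X p = F a p" by (simp add: b)
qed

lemma deriv_along_const: "X \<in> vfields A \<Longrightarrow> deriv_along X (\<lambda>p. c) = (\<lambda>p. 0)"
proof
  fix p assume "X \<in> vfields A"
  then have "X p \<in> tangent_space A p" by (auto simp: vfields_def)
  then show "deriv_along X (\<lambda>p. c) p = 0"
    by (simp add: deriv_along_def tangent_vec_const[OF manifold])
qed

lemma D_vfields: "X \<in> vfields A \<Longrightarrow> Y \<in> vfields A \<Longrightarrow> D X Y \<in> vfields A"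
  using levi_civita unfolding levi_civita_def affine_connection_def by blast

text \<open>The Koszul formula; its three terms that differentiate scalar products are absent because
  these products are constant.\<close>

lemma koszul:
  "2 * g p (D (F a) (F b) p) (F c p) = eta (br a b) c - eta (br b c) a + eta (br c a) b"
proof -
  have tan: "D (F a) (F b) p \<in> tangent_space A p" for a b
    using D_vfields[OF const_field_vfields const_field_vfields] by (auto simp: vfields_def)
  let ?G = "\<lambda>a b c. g p (D (F a) (F b) p) (F c p)"
  have compat: "?G a b c + ?G a c b = 0" for a b c
  proof -
    have "deriv_along (F a) (metric_on g (F b) (F c)) =
        metric_on g (D (F a) (F b)) (F c) + metric_on g (F b) (D (F a) (F c))"
      using levi_civita const_field_vfields unfolding levi_civita_def by blast
    then have "metric_on g (D (F a) (F b)) (F c) + metric_on g (F b) (D (F a) (F c)) = (\<lambda>p. 0)"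
      by (simp add: metric_on_const deriv_along_const const_field_vfields)
    from fun_cong[OF this, of p] show ?thesis
      using metric_sym[OF const_field_tangent tan] by (simp add: metric_on_def)
  qed
  have torsion: "?G a b c = eta (br a b) c + ?G b a c" for a b c
  proof -
    have "D (F a) (F b) - D (F b) (F a) = F (br a b)"
      using levi_civita const_field_vfields unfolding levi_civita_def bracket_const[symmetric]
      by blast
    then have "D (F a) (F b) p = F (br a b) p + D (F b) (F a) p"
      by (metis diff_add_cancel plus_fun_apply)
    then show ?thesis
      by (simp add: metric_add_left const_field_tangent tan metric_const)
  qed
  \<comment> \<open>Compatibility turns the products over in their last two indices, torsion-freeness in their
    first two; six such exchanges lead from the product back to its negative.\<close>
  show ?thesis
    using compat[of a b c] compat[of b c a] compat[of c a b]
      torsion[of a b c] torsion[of b c a] torsion[of c a b]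
    by linarith
qed

text \<open>The index in the Koszul formula is raised with the inverse metric, whose diagonal entries are
  again the \<open>\<epsilon> i\<close>.\<close>

definition nabla :: "real^'n \<Rightarrow> real^'n \<Rightarrow> real^'n" where
  "nabla a b = (\<chi> i. \<epsilon> i / 2 *
     (eta (br a b) (axis i 1) - eta (br b (axis i 1)) a + eta (br (axis i 1) a) b))"

lemma D_const: "D (F a) (F b) = F (nabla a b)"
proof (rule vfield_eq_const)
  show "D (F a) (F b) \<in> vfields A"
    by (intro D_vfields const_field_vfields)
  fix i p
  show "g p (D (F a) (F b) p) (E i p) = \<epsilon> i * nabla a b $ i"
    using koszul[of p a b "axis i 1"] eps_square[of i]
    by (simp add: nabla_def const_field_axis mult.assoc[symmetric])
qed

definition curv :: "real^'n \<Rightarrow> real^'n \<Rightarrow> real^'n \<Rightarrow> real^'n" where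
  "curv a b c = nabla (br a b) c - (nabla a (nabla b c) - nabla b (nabla a c))"

lemma curvature_const: "curvature D (F a) (F b) (F c) = F (curv a b c)"
  by (simp add: curvature_def curv_def bracket_const D_const const_field_diff)

definition ric :: "real^'n \<Rightarrow> real^'n \<Rightarrow> real" where
  "ric a b = (\<Sum>i\<in>UNIV. curv a (axis i 1) b $ i)"

lemma ricci_const: "ricci E D (F a) (F b) = (\<lambda>p. ric a b)"
proof
  fix p
  have "curvature D (F a) (E i) (F b) = F (curv a (axis i 1) b)" for i
    using curvature_const[of a "axis i 1" b] by (simp add: const_field_axis)
  then show "ricci E D (F a) (F b) p = ric a b"
    by (simp add: ricci_def trace_at_def trace_def ric_def frame_coord_const)
qed

lemma gram_frame: "gram E g p = (\<chi> i j. if i = j then \<epsilon> i else 0)"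
  using metric_frame by (simp add: gram_def metric_on_def)

lemma gram_inv: "matrix_inv (gram E g p) = gram E g p"
proof -
  have square: "gram E g p ** gram E g p = mat 1"
    using eps_square
    by (simp add: gram_frame matrix_matrix_mult_def mat_def vec_eq_iff
        if_distrib[of "\<lambda>x. x * _"] if_distrib[of "\<lambda>x. _ * x"] cong: if_cong)
  then have "gram E g p ** matrix_inv (gram E g p) = mat 1 \<and>
      matrix_inv (gram E g p) ** gram E g p = mat 1"
    unfolding matrix_inv_def by (intro someI) simp
  with square show ?thesis
    by (metis matrix_mul_assoc matrix_mul_lid matrix_mul_rid)
qed

lemma scalar_curvature_const:
  "scalar_curvature E g D = (\<lambda>p. \<Sum>i\<in>UNIV. \<epsilon> i * ric (axis i 1) (axis i 1))"
proof
  fix p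
  have "ricci E D (E i) (E j) p = ric (axis i 1) (axis j 1)" for i j
    using ricci_const[of "axis i 1" "axis j 1"] by (simp add: const_field_axis)
  then show "scalar_curvature E g D p = (\<Sum>i\<in>UNIV. \<epsilon> i * ric (axis i 1) (axis i 1))"
    by (simp add: scalar_curvature_def gram_inv) (simp add: gram_frame
        if_distrib[of "\<lambda>x. x * _"] cong: if_cong)
qed

lemma lie_deriv_metric_const:
  "lie_deriv_metric g (F x) (F a) (F b) = (\<lambda>p. - eta (br x a) b - eta a (br x b))"
  by (simp add: lie_deriv_metric_def bracket_const metric_on_const
      deriv_along_const const_field_vfields fun_eq_iff)

end


section \<open>The Cotton tensor of Type Ib\<close>

definition type_Ib_bracket :: "real \<Rightarrow> real \<Rightarrow> real \<Rightarrow> real^3 \<Rightarrow> real^3 \<Rightarrow> real^3" where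
  "type_Ib_bracket \<alpha> \<beta> \<gamma> a b = vector
     [\<alpha> * (a $ 2 * b $ 3 - a $ 3 * b $ 2),
      \<beta> * (a $ 1 * b $ 2 - a $ 2 * b $ 1) - \<gamma> * (a $ 1 * b $ 3 - a $ 3 * b $ 1),
      - \<gamma> * (a $ 1 * b $ 2 - a $ 2 * b $ 1) - \<beta> * (a $ 1 * b $ 3 - a $ 3 * b $ 1)]"

locale type_Ib_frame =
  orthonormal_frame A g D E "\<lambda>i. if i = 3 then - 1 else 1" "type_Ib_bracket \<alpha> \<beta> \<gamma>"
  for A :: "('a::{t2_space, second_countable_topology}, real^3) atlas"
    and g :: "'a metric" and D :: "'a connection" and E :: "3 \<Rightarrow> 'a vfield"
    and \<alpha> \<beta> \<gamma> :: real
begin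

lemma eta_Ib: "eta a b = a $ 1 * b $ 1 + a $ 2 * b $ 2 - a $ 3 * b $ 3"
  by (simp add: eta_def sum_3)

lemma nabla_Ib:
  "nabla a b = vector
     [\<beta> * (a $ 2 * b $ 2 + a $ 3 * b $ 3) + \<alpha> / 2 * (a $ 2 * b $ 3 - a $ 3 * b $ 2),
      (\<alpha> / 2 - \<gamma>) * a $ 1 * b $ 3 - \<beta> * a $ 2 * b $ 1 + \<alpha> / 2 * a $ 3 * b $ 1,
      (\<alpha> / 2 - \<gamma>) * a $ 1 * b $ 2 + \<alpha> / 2 * a $ 2 * b $ 1 + \<beta> * a $ 3 * b $ 1]"
  by (simp add: nabla_def vec_eq_iff forall_3 eta_Ib type_Ib_bracket_def axis_def field_simps)

lemma ric_Ib:
  "ric a b = - (\<alpha>\<^sup>2 / 2 + 2 * \<beta>\<^sup>2) * a $ 1 * b $ 1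
     + (\<alpha>\<^sup>2 / 2 - \<alpha> * \<gamma>) * (a $ 2 * b $ 2 - a $ 3 * b $ 3)
     + (2 * \<beta> * \<gamma> - \<alpha> * \<beta>) * (a $ 2 * b $ 3 + a $ 3 * b $ 2)"
  by (simp add: ric_def curv_def sum_3 nabla_Ib type_Ib_bracket_def axis_def field_simps
      power2_eq_square)

text \<open>The coefficient \<open>\<alpha>\<^sup>2 / 2 - 2 \<alpha> \<gamma> - 2 \<beta>\<^sup>2\<close> is the scalar curvature.\<close>

definition schout :: "real^3 \<Rightarrow> real^3 \<Rightarrow> real" where
  "schout a b = ric a b - (\<alpha>\<^sup>2 / 2 - 2 * \<alpha> * \<gamma> - 2 * \<beta>\<^sup>2) / 4 * eta a b"

lemma schouten_const: "schouten E g D (F a) (F b) = (\<lambda>p. schout a b)"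
proof -
  have "scalar_curvature E g D = (\<lambda>p. \<alpha>\<^sup>2 / 2 - 2 * \<alpha> * \<gamma> - 2 * \<beta>\<^sup>2)"
    by (simp add: scalar_curvature_const sum_3 ric_Ib axis_def) (simp add: fun_eq_iff field_simps)
  then show ?thesis
    by (simp add: schouten_def schout_def ricci_const metric_on_const)
qed

text \<open>The difference of covariant derivatives defining the Cotton tensor, with
  \<open>S(\<nabla>\<^sub>a b - \<nabla>\<^sub>b a, c)\<close> simplified to \<open>S([a,b], c)\<close> by the vanishing of the torsion.\<close>

definition cotton :: "real^3 \<Rightarrow> real^3 \<Rightarrow> real^3 \<Rightarrow> real" where
  "cotton a b c = schout a (nabla b c) - schout b (nabla a c) - schout (type_Ib_bracket \<alpha> \<beta> \<gamma> a b) c"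

lemma cotton03_const: "cotton03 E g D (F a) (F b) (F c) = (\<lambda>p. cotton a b c)"
proof -
  have "cov_deriv D (schouten E g D) (F a) (F b) (F c) =
      (\<lambda>p. - schout (nabla a b) c - schout b (nabla a c))" for a b c
    by (simp add: cov_deriv_def D_const schouten_const deriv_along_const const_field_vfields
        fun_eq_iff)
  moreover have "schout (nabla a b) c - schout (nabla b a) c = schout (type_Ib_bracket \<alpha> \<beta> \<gamma> a b) c"
    by (simp add: schout_def ric_Ib eta_Ib nabla_Ib type_Ib_bracket_def field_simps)
  ultimately show ?thesis
    by (simp add: cotton03_def cotton_def fun_eq_iff)
qed

text \<open>For each \<open>j\<close> only two terms of the contraction survive. They are equal, by antisymmetry of the
  Cotton tensor in its first two arguments, which cancels the factor 1/2. The sign for \<open>j = 3\<close> is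
  that of \<open>g\<^sub>3\<^sub>3\<close>.\<close>

lemma cotton02_comp_const:
  "cotton02_comp E g D i j p =
     (if j = 1 then cotton (axis 2 1) (axis 3 1) (axis i 1)
      else if j = 2 then cotton (axis 3 1) (axis 1 1) (axis i 1)
      else - cotton (axis 1 1) (axis 2 1) (axis i 1))"
proof -
  have c: "cotton03 E g D (E n) (E m) (E i) p = cotton (axis n 1) (axis m 1) (axis i 1)" for n m
    using cotton03_const[of "axis n 1" "axis m 1" "axis i 1"] by (simp add: const_field_axis)
  have "cotton a b c = - cotton b a c" for a b c
    by (simp add: cotton_def schout_def ric_Ib eta_Ib type_Ib_bracket_def field_simps)
  then have flip: "cotton (axis 3 1) (axis 2 1) c = - cotton (axis 2 1) (axis 3 1) c"
    "cotton (axis 1 1) (axis 3 1) c = - cotton (axis 3 1) (axis 1 1) c"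
    "cotton (axis 2 1) (axis 1 1) c = - cotton (axis 1 1) (axis 2 1) c" for c
    by blast+
  have "det (gram E g p) = - 1"
    by (simp add: gram_frame det_3)
  then show ?thesis
    using exhaust_3[of j]
    by (auto simp: cotton02_comp_def c sum_3 gram_frame levi_civita_symbol_def flip)
qed

lemma cotton02_frame: "cotton02 E g D (E i) (E j) p = cotton02_comp E g D i j p"
proof -
  have "frame_coord E p (E i p) = axis i 1" for i
    using frame_coord_const[of p "axis i 1"] by (simp add: const_field_axis)
  then show ?thesis
    by (simp add: cotton02_def axis_def if_distrib[of "\<lambda>x. x * _"] if_distrib[of "\<lambda>x. _ * x"]
        cong: if_cong)
qed

text \<open>The components that rule out solitons: the mixed ones vanish, because the rotation
  \<open>e\<^sub>2 \<mapsto> - e\<^sub>2\<close>, \<open>e\<^sub>3 \<mapsto> - e\<^sub>3\<close> is an isometric automorphism of the Lie algebra, and the last identity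
  expresses that the Cotton operator has equal diagonal entries on the plane of \<open>e\<^sub>2, e\<^sub>3\<close>.\<close>

lemma cotton02_Ib:
  "cotton02 E g D (E 1) (E 2) p = 0"
  "cotton02 E g D (E 1) (E 3) p = 0"
  "cotton02 E g D (E 2) (E 2) p + cotton02 E g D (E 3) (E 3) p = 0"
  by (simp_all add: cotton02_frame cotton02_comp_const cotton_def schout_def ric_Ib eta_Ib
      nabla_Ib type_Ib_bracket_def axis_def field_simps power2_eq_square)

lemma lie_deriv_metric_frame:
  "lie_deriv_metric g (F x) (E i) (E j) p =
     - eta (type_Ib_bracket \<alpha> \<beta> \<gamma> x (axis i 1)) (axis j 1)
     - eta (axis i 1) (type_Ib_bracket \<alpha> \<beta> \<gamma> x (axis j 1))"
  using fun_cong[OF lie_deriv_metric_const[of x "axis i 1" "axis j 1"], of p]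
  by (simp add: const_field_axis)

lemma cotton_soliton_zero:
  assumes "\<beta> \<noteq> 0" and "cotton_soliton A E g D (F x)"
  shows "x = 0"
proof -
  obtain c where c: "lie_deriv_metric g (F x) (E i) (E j) p + cotton02 E g D (E i) (E j) p =
      c * metric_on g (E i) (E j) p" for i j p
    using assms(2) frame_vfields unfolding cotton_soliton_def by blast
  note expand = lie_deriv_metric_frame cotton02_Ib metric_frame eta_Ib type_Ib_bracket_def axis_def
  have "\<beta> * x $ 2 + (\<alpha> - \<gamma>) * x $ 3 = 0" and "\<beta> * x $ 3 - (\<alpha> - \<gamma>) * x $ 2 = 0"
    using c[of 1 2] c[of 1 3] by (simp_all add: expand algebra_simps)
  \<comment> \<open>The matrix of this system is a rotation times a scaling; eliminate with its transpose.\<close>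
  then have "(\<beta>\<^sup>2 + (\<alpha> - \<gamma>)\<^sup>2) * x $ 2 = 0" and "(\<beta>\<^sup>2 + (\<alpha> - \<gamma>)\<^sup>2) * x $ 3 = 0"
    by algebra+
  moreover have "\<beta>\<^sup>2 + (\<alpha> - \<gamma>)\<^sup>2 \<noteq> 0"
    using \<open>\<beta> \<noteq> 0\<close> by (simp add: sum_power2_eq_zero_iff)
  ultimately have "x $ 2 = 0" and "x $ 3 = 0" by auto
  moreover have "x $ 1 = 0"
  proof -
    \<comment> \<open>Adding these two components eliminates the constant \<open>c\<close>, as the metric has opposite signs
      there.\<close>
    have "- 4 * \<beta> * x $ 1 +
        (cotton02 E g D (E 2) (E 2) p + cotton02 E g D (E 3) (E 3) p) = 0" for p
      using c[of 2 2 p] c[of 3 3 p]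
      by (simp add: lie_deriv_metric_frame metric_frame eta_Ib type_Ib_bracket_def axis_def)
    then show ?thesis
      using \<open>\<beta> \<noteq> 0\<close> unfolding cotton02_Ib(3) by simp
  qed
  ultimately show ?thesis by (simp add: vec_eq_iff forall_3)
qed

end


section \<open>Left-invariant Cotton solitons\<close>

lemma deriv_along_const_field:
  "deriv_along (const_field E a) f = (\<lambda>p. \<Sum>i\<in>UNIV. a $ i * deriv_along (E i) f p)"
  by (simp add: deriv_along_def const_field_def)

text \<open>Bilinearity of the bracket uses the linearity of tangent vectors on the functions
  \<open>deriv_along (E j) f\<close>, which are smooth when \<open>f\<close> is and vanish identically when \<open>f\<close> is not.\<close>

lemma bracket_const_field:
  assumes A: "smooth_manifold A" and E: "\<And>i. E i \<in> vfields A"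
  shows "bracket (const_field E a) (const_field E b) =
    (\<lambda>p f. \<Sum>i\<in>UNIV. \<Sum>j\<in>UNIV. a $ i * b $ j * bracket (E i) (E j) p f)"
proof (intro ext)
  fix p f
  have tan: "E i p \<in> tangent_space A p" for i
    using E by (auto simp: vfields_def)
  have app: "E i p (deriv_along (const_field E c) f) =
      (\<Sum>j\<in>UNIV. c $ j * E i p (deriv_along (E j) f))" for i c
  proof (cases "smooth_fun A f")
    case True
    then have "smooth_fun A (deriv_along (E j) f)" for j
      using E by (auto simp: vfields_def)
    then show ?thesis
      unfolding deriv_along_const_field by (intro tangent_vec_sum_fun[OF A tan])
  next
    case False
    then have "deriv_along (E j) f = (\<lambda>p. 0)" for j
      using tangent_space_nonsmooth[OF _ False] E
      unfolding vfields_def deriv_along_def by (auto intro!: ext)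
    then show ?thesis
      by (simp add: deriv_along_const_field tangent_vec_const[OF A tan])
  qed
  have expand: "const_field E c p h = (\<Sum>i\<in>UNIV. c $ i * E i p h)" for c h
    by (simp add: const_field_def)
  show "bracket (const_field E a) (const_field E b) p f =
      (\<Sum>i\<in>UNIV. \<Sum>j\<in>UNIV. a $ i * b $ j * bracket (E i) (E j) p f)"
    unfolding bracket_def expand app
    by (simp add: sum_distrib_left right_diff_distrib sum_subtractf mult_ac)
      (rule sum.swap)
qed

theorem theorem4:
  fixes A :: "('a::{t2_space, second_countable_topology}, real^3) atlas"
    and mul :: "'a \<Rightarrow> 'a \<Rightarrow> 'a" and u :: 'a and ginv :: "'a \<Rightarrow> 'a"
    and g :: "'a metric" and D :: "'a connection"
    and e :: "3 \<Rightarrow> 'a vfield" and \<alpha> \<beta> \<gamma> :: real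
  assumes "lie_group A mul u ginv"
    and "connected (UNIV :: 'a set)" and "simply_connected (UNIV :: 'a set)"
    and "left_invariant_metric A mul g"
    and "levi_civita A g D"
    and "lie_algebra_basis A mul e"
    and "lorentz_orthonormal g e"
    and "bracket (e 1) (e 2) = (\<lambda>_. \<beta>) \<odot> e 2 - (\<lambda>_. \<gamma>) \<odot> e 3"
    and "bracket (e 1) (e 3) = (\<lambda>_. - \<gamma>) \<odot> e 2 - (\<lambda>_. \<beta>) \<odot> e 3"
    and "bracket (e 2) (e 3) = (\<lambda>_. \<alpha>) \<odot> e 1"
    and "\<beta> \<noteq> 0"
  shows "\<not> (\<exists>X \<in> lie_algebra A mul. X \<noteq> 0 \<and> cotton_soliton A e g D X)"
proof (intro notI, elim bexE conjE)
  fix X assume X: "X \<in> lie_algebra A mul" "X \<noteq> 0" "cotton_soliton A e g D X"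
  have manifold: "smooth_manifold A"
    using assms(1) by (simp add: lie_group_def)
  have frame: "e i \<in> vfields A" for i
    using assms(6) by (simp add: lie_algebra_basis_def lie_algebra_def)
  have bracket_apply: "bracket (e 1) (e 2) p f = \<beta> * e 2 p f - \<gamma> * e 3 p f"
    "bracket (e 1) (e 3) p f = - \<gamma> * e 2 p f - \<beta> * e 3 p f"
    "bracket (e 2) (e 3) p f = \<alpha> * e 1 p f" for p f
    by (simp_all add: assms(8-10) fscale_def)
  have bracket_flip: "bracket (e i) (e j) p f = - bracket (e j) (e i) p f" for i j p f
    by (simp add: bracket_def)
  have bracket_self: "bracket (e i) (e i) p f = 0" for i p f
    by (simp add: bracket_def)
  interpret type_Ib_frame A g D e \<alpha> \<beta> \<gamma>
  proof
    show "smooth_manifold A" by fact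
    show "pseudo_riemannian_metric A g"
      using assms(4) by (simp add: left_invariant_metric_def)
    show "levi_civita A g D" by fact
    show "e i \<in> vfields A" for i by fact
    show "metric_on g (e i) (e j) p = (if i = j then if i = 3 then - 1 else 1 else 0)" for i j p
      using assms(7) by (simp add: lorentz_orthonormal_def)
    show "bracket (const_field e a) (const_field e b) =
        const_field e (type_Ib_bracket \<alpha> \<beta> \<gamma> a b)" for a b
      unfolding bracket_const_field[OF manifold frame]
      by (simp add: fun_eq_iff sum_3 bracket_self bracket_flip[of 2 1] bracket_flip[of 3 1]
          bracket_flip[of 3 2] bracket_apply const_field_def type_Ib_bracket_def algebra_simps)
  qed simp
  obtain x where x: "X = const_field e x"
    using assms(6) X(1) by (auto simp: lie_algebra_basis_def sum_fscale_eq_const_field)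
  then have "x = 0"
    using cotton_soliton_zero \<open>\<beta> \<noteq> 0\<close> X(3) by blast
  then show False
    using X(2) by (simp add: x const_field_zero)
qed

end
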